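(* Let $n\ge2$ and let $G=\langle \mathcal{F}\rangle$ be an $n$-chain group with distinguished generating set $\mathcal{F}=\{f_1,\dots,f_n\}$. Then for all sufficiently large natural numbers $N$ (larger than some bound depending on $\mathcal{F}$), the group $G_N=\langle f^N\mid f\in\mathcal{F}\rangle$ is isomorphic to the Higman--Thompson group $F_n$.
   Context: $\mathrm{Homeo}^+(\mathbb{R})$ is the group of orientation preserving homeomorphisms of $\mathbb{R}$; $\operatorname{supp} f=\{x: f(x)\ne x\}$. For an interval $J$, $\partial^-J$ is its left endpoint. Chain of intervals: a collection $\{J_1,\ldots,J_n\}$ of nonempty open subintervals of $\mathbb{R}$ (possibly unbounded) such that $J_i\cap J_k=\varnothing$ if $|i-k|>1$, and $J_i\cap J_{i+1}$ is a proper nonempty subinterval of both $J_i$ and $J_{i+1}$ for $1\le i\le n-1$. $n$-chain group ($n\ge 2$) with distinguished generating set $\mathcal{F}=\{f_1,\dots,f_n\}$: the group $\langle f_1,\ldots,f_n\rangle\le\mathrm{Homeo}^+(\mathbb{R})$ where $\{\operatorname{supp} f_1,\dots,\operatorname{supp} f_n\}$ is a chain of intervals with $\partial^-\operatorname{supp} f_i<\partial^-\operatorname{supp} f_{i+1}$ for all $i<n$, $f_i(t)\ge t$ for all $t$ and $i$, and $\langle f_i,f_{i+1}\rangle\cong F$ for each $1\le i\le n-1$. The Higman--Thompson group is $F_n=\langle \{g_i\}_{i\ge0}\mid g_i^{-1}g_jg_i=g_{j+n-1}\text{ for }0\le i<j\rangle$, and $F=F_2$ is Thompson's group. *)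

theory Defs
  imports "HOL-Analysis.Analysis" "HOL-Algebra.Elementary_Groups"
begin

subsection \<open>Groups given by generators and relations\<close>

text \<open>
  A word is a list of letters \<open>(x, b)\<close>: the generator \<open>x\<close> if \<open>b\<close> is \<open>True\<close>, its formal
  inverse if \<open>b\<close> is \<open>False\<close>. A pair \<open>(l, r)\<close> in \<open>R\<close> stands for the relation \<open>l = r\<close>.
\<close>

type_synonym 'a word = "('a \<times> bool) list"

inductive word_eq :: "('a word \<times> 'a word) set \<Rightarrow> 'a word \<Rightarrow> 'a word \<Rightarrow> bool"
  for R :: "('a word \<times> 'a word) set"
where
  refl: "word_eq R u u"
| sym: "word_eq R u v \<Longrightarrow> word_eq R v u"
| trans: "word_eq R u v \<Longrightarrow> word_eq R v w \<Longrightarrow> word_eq R u w"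
| cancel: "word_eq R (u @ [(x, b), (x, \<not> b)] @ v) (u @ v)"
| rel: "(l, r) \<in> R \<Longrightarrow> word_eq R (u @ l @ v) (u @ r @ v)"

definition word_class :: "('a word \<times> 'a word) set \<Rightarrow> 'a word \<Rightarrow> 'a word set" where
  "word_class R u = {v. word_eq R u v}"

definition presented_group :: "('a word \<times> 'a word) set \<Rightarrow> 'a word set monoid" where
  "presented_group R =
     \<lparr>carrier = range (word_class R),
      mult = (\<lambda>A B. \<Union>a\<in>A. \<Union>b\<in>B. word_class R (a @ b)),
      one = word_class R []\<rparr>"

lemma word_class_eq_iff: "word_class R u = word_class R v \<longleftrightarrow> word_eq R u v"
  unfolding word_class_def set_eq_iff mem_Collect_eq
  by (meson word_eq.refl word_eq.sym word_eq.trans)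

lemma word_eq_append:
  assumes "word_eq R u u'" "word_eq R v v'"
  shows "word_eq R (u @ v) (u' @ v')"
proof -
  have 1: "word_eq R (p @ x @ q) (p @ y @ q)" if "word_eq R x y" for p x y q
    using that
  proof (induction rule: word_eq.induct)
    case (cancel u x b v)
    show ?case using word_eq.cancel[of R "p @ u" x b "v @ q"] by simp
  next
    case (rel l r u v)
    then show ?case using word_eq.rel[of l r R "p @ u" "v @ q"] by simp
  next
    case (refl u)
    show ?case by (rule word_eq.refl)
  next
    case (sym u v)
    from sym.IH show ?case by (rule word_eq.sym)
  next
    case (trans u v w)
    from trans.IH show ?case by (rule word_eq.trans)
  qed
  show ?thesis
    using word_eq.trans[OF 1[OF assms(1), of "[]" v, simplified] 1[OF assms(2), of u' "[]", simplified]] .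
qed

lemma presented_group_mult:
  "word_class R u \<otimes>\<^bsub>presented_group R\<^esub> word_class R v = word_class R (u @ v)"
proof -
  have eq: "word_class R (a @ b) = word_class R (u @ v)"
    if "a \<in> word_class R u" "b \<in> word_class R v" for a b
  proof -
    have "word_eq R (u @ v) (a @ b)"
      using that unfolding word_class_def by (intro word_eq_append) simp_all
    then show ?thesis unfolding word_class_eq_iff by (rule word_eq.sym)
  qed
  have ne: "word_class R w \<noteq> {}" for w
    using word_eq.refl[of R w] unfolding word_class_def by blast
  have "(\<Union>a\<in>word_class R u. \<Union>b\<in>word_class R v. word_class R (a @ b))
      = (\<Union>a\<in>word_class R u. \<Union>b\<in>word_class R v. word_class R (u @ v))"
    by (intro SUP_cong HOL.refl) (rule eq)
  also have "\<dots> = word_class R (u @ v)"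
    by (simp only: cSUP_const[OF ne])
  finally show ?thesis
    by (simp only: presented_group_def monoid.simps)
qed

lemma group_presented_group: "group (presented_group R)"
proof (rule groupI)
  have car: "carrier (presented_group R) = range (word_class R)"
    and one: "\<one>\<^bsub>presented_group R\<^esub> = word_class R []"
    by (simp_all add: presented_group_def)
  note [simp] = car one presented_group_mult
  show "\<one>\<^bsub>presented_group R\<^esub> \<in> carrier (presented_group R)"
    by simp
  show "x \<otimes>\<^bsub>presented_group R\<^esub> y \<in> carrier (presented_group R)"
    if "x \<in> carrier (presented_group R)" "y \<in> carrier (presented_group R)" for x y
    using that by auto
  show "x \<otimes>\<^bsub>presented_group R\<^esub> y \<otimes>\<^bsub>presented_group R\<^esub> z
      = x \<otimes>\<^bsub>presented_group R\<^esub> (y \<otimes>\<^bsub>presented_group R\<^esub> z)"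
    if "x \<in> carrier (presented_group R)" "y \<in> carrier (presented_group R)"
      "z \<in> carrier (presented_group R)" for x y z
    using that by auto
  show "\<one>\<^bsub>presented_group R\<^esub> \<otimes>\<^bsub>presented_group R\<^esub> x = x"
    if "x \<in> carrier (presented_group R)" for x
    using that by auto
  show "\<exists>y\<in>carrier (presented_group R). y \<otimes>\<^bsub>presented_group R\<^esub> x = \<one>\<^bsub>presented_group R\<^esub>"
    if x: "x \<in> carrier (presented_group R)" for x
  proof -
    from x obtain u where u: "x = word_class R u" by auto
    have "\<exists>w. word_eq R (w @ u) []"
    proof (induction u)
      case Nil
      show ?case using word_eq.refl[of R "[]"] by (metis append_Nil)
    next
      case (Cons a u)
      obtain y b where a: "a = (y, b)" by force
      from Cons obtain w where w: "word_eq R (w @ u) []" by blast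
      have "word_eq R ((w @ [(y, \<not> b)]) @ a # u) (w @ u)"
        using word_eq.cancel[of R w y "\<not> b" u] a by simp
      with w show ?case by (blast intro: word_eq.trans)
    qed
    with u show ?thesis by (auto simp: word_class_eq_iff)
  qed
qed


subsection \<open>The Higman--Thompson groups\<close>

text \<open>The relations \<open>g\<^sub>i\<inverse> g\<^sub>j g\<^sub>i = g\<^bsub>j+n-1\<^esub>\<close> for \<open>i < j\<close>; only used for \<open>n \<ge> 2\<close>.\<close>

definition HT_relations :: "nat \<Rightarrow> (nat word \<times> nat word) set" where
  "HT_relations n =
     {([(i, False), (j, True), (i, True)], [(j + n - 1, True)]) | i j. i < j}"

definition Higman_Thompson :: "nat \<Rightarrow> nat word set monoid" where
  "Higman_Thompson n = presented_group (HT_relations n)"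

abbreviation Thompson_F :: "nat word set monoid" where
  "Thompson_F \<equiv> Higman_Thompson 2"


subsection \<open>Orientation preserving homeomorphisms of the line\<close>

definition Homeo_plus :: "(real \<Rightarrow> real) monoid" where
  "Homeo_plus =
     \<lparr>carrier = {f. (\<exists>g. homeomorphism UNIV UNIV f g) \<and> strict_mono f},
      mult = (\<circ>),
      one = id\<rparr>"

lemma group_Homeo_plus: "group Homeo_plus"
proof (rule groupI)
  show "f \<otimes>\<^bsub>Homeo_plus\<^esub> g \<in> carrier Homeo_plus"
    if "f \<in> carrier Homeo_plus" "g \<in> carrier Homeo_plus" for f g
  proof -
    from that obtain f' g' where "homeomorphism UNIV UNIV f f'" "homeomorphism UNIV UNIV g g'"
      by (auto simp: Homeo_plus_def)
    then have "homeomorphism UNIV UNIV (f \<circ> g) (g' \<circ> f')"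
      by (metis homeomorphism_compose)
    with that show ?thesis
      by (auto simp: Homeo_plus_def strict_mono_def)
  qed
  show "\<one>\<^bsub>Homeo_plus\<^esub> \<in> carrier Homeo_plus"
    using homeomorphism_ident[of UNIV] by (auto simp: Homeo_plus_def strict_mono_def id_def)
  show "\<exists>g\<in>carrier Homeo_plus. g \<otimes>\<^bsub>Homeo_plus\<^esub> f = \<one>\<^bsub>Homeo_plus\<^esub>"
    if f: "f \<in> carrier Homeo_plus" for f
  proof -
    from f obtain g where g: "homeomorphism UNIV UNIV f g" and m: "strict_mono f"
      by (auto simp: Homeo_plus_def)
    have gf: "g (f x) = x" and fg: "f (g x) = x" for x
      using g by (auto simp: homeomorphism_def)
    have "strict_mono g"
      unfolding strict_mono_def using strict_mono_less[OF m] fg by metis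
    moreover have "homeomorphism UNIV UNIV g f"
      using g by (rule homeomorphism_symD)
    ultimately show ?thesis
      using gf by (intro bexI[of _ g]) (auto simp: Homeo_plus_def fun_eq_iff)
  qed
qed (auto simp: Homeo_plus_def)

definition supp :: "(real \<Rightarrow> real) \<Rightarrow> real set" where
  "supp f = {x. f x \<noteq> x}"


subsection \<open>Chain groups\<close>

text \<open>Intervals may be unbounded, so endpoints are extended reals.\<close>

definition left_endpoint :: "real set \<Rightarrow> ereal" where
  "left_endpoint J = (INF x\<in>J. ereal x)"

definition chain_of_intervals :: "nat \<Rightarrow> (nat \<Rightarrow> real set) \<Rightarrow> bool" where
  "chain_of_intervals n J \<longleftrightarrow>
     (\<forall>i\<in>{1..n}. J i \<noteq> {} \<and> open (J i) \<and> is_interval (J i)) \<and>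
     (\<forall>i\<in>{1..n}. \<forall>k\<in>{1..n}. \<bar>int i - int k\<bar> > 1 \<longrightarrow> J i \<inter> J k = {}) \<and>
     (\<forall>i\<in>{1..<n}. J i \<inter> J (i + 1) \<noteq> {} \<and>
        J i \<inter> J (i + 1) \<subset> J i \<and> J i \<inter> J (i + 1) \<subset> J (i + 1))"

text \<open>
  \<open>chain_group n f G\<close>: \<open>G\<close> is an \<open>n\<close>-chain group with distinguished generating set
  \<open>{f 1, \<dots>, f n}\<close>.
\<close>

definition chain_group :: "nat \<Rightarrow> (nat \<Rightarrow> real \<Rightarrow> real) \<Rightarrow> (real \<Rightarrow> real) monoid \<Rightarrow> bool" where
  "chain_group n f G \<longleftrightarrow>
     n \<ge> 2 \<and>
     f ` {1..n} \<subseteq> carrier Homeo_plus \<and>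
     chain_of_intervals n (\<lambda>i. supp (f i)) \<and>
     (\<forall>i\<in>{1..<n}. left_endpoint (supp (f i)) < left_endpoint (supp (f (i + 1)))) \<and>
     (\<forall>i\<in>{1..n}. \<forall>t. f i t \<ge> t) \<and>
     (\<forall>i\<in>{1..<n}. subgroup_generated Homeo_plus {f i, f (i + 1)} \<cong> Thompson_F) \<and>
     G = subgroup_generated Homeo_plus (f ` {1..n})"

end

theory Submission
  imports Defs
begin

text \<open>
  Put \<open>h\<^sub>i = f\<^sub>i\<^sup>N\<close>, let \<open>a\<^sub>i\<close> and \<open>b\<^sub>i\<close> be the endpoints of its support, and
  \<open>P = h\<^sub>n \<circ> \<dots> \<circ> h\<^sub>1\<close>. Points climb through the overlaps of consecutive supports, so
  \<open>P a\<^sub>2 \<ge> b\<^bsub>n-1\<^esub>\<close> for large \<open>N\<close>. Let \<open>y\<^sub>j = h\<^sub>n \<circ> \<dots> \<circ> h\<^bsub>j+1\<^esub>\<close> for \<open>j < n\<close> and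
  \<open>y\<^bsub>j+n-1\<^esub> = P \<circ> y\<^sub>j \<circ> P\<inverse>\<close> for \<open>j \<ge> 1\<close>. For \<open>i < j\<close> and \<open>i < n\<close> the map \<open>P\<close> is \<open>y\<^sub>i\<close> after
  \<open>h\<^sub>i \<circ> \<dots> \<circ> h\<^sub>1\<close>, whose support lies to the left of that of \<open>y\<^sub>j\<close>; hence
  \<open>y\<^sub>i \<circ> y\<^sub>j = y\<^bsub>j+n-1\<^esub> \<circ> y\<^sub>i\<close>, and the inverses \<open>g\<^sub>j = y\<^sub>j\<inverse>\<close> satisfy the Higman--Thompson relations.

  For faithfulness, every element is a fraction of two words in the letters \<open>y\<^sub>j\<close>. If two such words
  act equally, collect the letter \<open>y\<^sub>k\<close> of least index at the right end of both. Since \<open>y\<^sub>j\<close> with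
  \<open>j > k\<close> fixes everything up to the left endpoint \<open>A\<^bsub>k+1\<^esub>\<close> of the support of \<open>y\<^bsub>k+1\<^esub>\<close>, while
  \<open>y\<^sub>k\<close> moves \<open>A\<^bsub>k+1\<^esub>\<close>, the exponents of \<open>y\<^sub>k\<close> agree and can be cancelled.
\<close>

section \<open>Homomorphisms out of presented groups\<close>

primrec word_eval :: "('g, 'm) monoid_scheme \<Rightarrow> ('a \<Rightarrow> 'g) \<Rightarrow> 'a word \<Rightarrow> 'g" where
  "word_eval G h [] = \<one>\<^bsub>G\<^esub>"
| "word_eval G h (l # w) = (if snd l then h (fst l) else inv\<^bsub>G\<^esub> h (fst l)) \<otimes>\<^bsub>G\<^esub> word_eval G h w"

context group
begin

lemma word_eval_closed:
  assumes "range h \<subseteq> carrier G"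
  shows "word_eval G h w \<in> carrier G"
  using assms by (induction w) auto

lemma word_eval_append:
  assumes "range h \<subseteq> carrier G"
  shows "word_eval G h (u @ v) = word_eval G h u \<otimes> word_eval G h v"
proof (induction u)
  case Nil
  then show ?case using assms by (simp add: word_eval_closed)
next
  case (Cons l u)
  have "h (fst l) \<in> carrier G" using assms by auto
  with Cons show ?case by (simp add: m_assoc word_eval_closed assms)
qed

lemma word_eval_cong:
  assumes h: "range h \<subseteq> carrier G"
    and R: "\<And>l r. (l, r) \<in> R \<Longrightarrow> word_eval G h l = word_eval G h r"
    and "word_eq R u v"
  shows "word_eval G h u = word_eval G h v"
  using assms(3)
proof induction
  case (cancel u x b v)
  have hx: "h x \<in> carrier G" using h by auto
  have "word_eval G h [(x, b), (x, \<not> b)] = \<one>" using hx by simp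
  then have "word_eval G h (u @ [(x, b), (x, \<not> b)] @ v) = word_eval G h u \<otimes> (\<one> \<otimes> word_eval G h v)"
    by (simp only: word_eval_append[OF h])
  then show ?case
    using word_eval_closed[OF h] by (simp add: word_eval_append[OF h])
next
  case (rel l r u v)
  then show ?case by (simp add: word_eval_append[OF h] R)
qed simp_all

lemma word_eval_image:
  assumes h: "range h \<subseteq> carrier G"
  shows "range (word_eval G h) = generate G (range h)"
proof
  have "word_eval G h w \<in> generate G (range h)" for w
    by (induction w) (auto intro: generate.intros)
  then show "range (word_eval G h) \<subseteq> generate G (range h)" by blast
  show "generate G (range h) \<subseteq> range (word_eval G h)"
  proof
    fix x assume "x \<in> generate G (range h)"
    then show "x \<in> range (word_eval G h)"
    proof induction
      case one
      show ?case using rangeI[of "word_eval G h" "[]"] by simp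
    next
      case (incl k)
      then obtain i where "k = h i" by auto
      moreover have "h i \<in> carrier G" using h by auto
      ultimately show ?case using rangeI[of "word_eval G h" "[(i, True)]"] by simp
    next
      case (inv k)
      then obtain i where "k = h i" by auto
      moreover have "h i \<in> carrier G" using h by auto
      ultimately show ?case using rangeI[of "word_eval G h" "[(i, False)]"] by simp
    next
      case (eng k l)
      then obtain u v where "k = word_eval G h u" "l = word_eval G h v" by blast
      then have "k \<otimes> l = word_eval G h (u @ v)" by (simp add: word_eval_append[OF h])
      then show ?case by blast
    qed
  qed
qed

lemma word_eval_inverse:
  assumes h: "range h \<subseteq> carrier G"
  shows "word_eval G h (map (\<lambda>i. (i, True)) xs) = inv (word_eval G h (map (\<lambda>i. (i, False)) (rev xs)))"
proof (induction xs)
  case (Cons i xs)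
  have [simp]: "h i \<in> carrier G" for i using h by auto
  show ?case
    by (simp add: Cons word_eval_append[OF h] inv_mult_group word_eval_closed[OF h])
qed simp

text \<open>Relations that hold in \<open>G\<close> make evaluation constant on word classes, and
  \<open>inj\<close> says that the resulting homomorphism has trivial kernel.\<close>

proposition presented_group_iso:
  assumes h: "range h \<subseteq> carrier G"
    and R: "\<And>l r. (l, r) \<in> R \<Longrightarrow> word_eval G h l = word_eval G h r"
    and inj: "\<And>w. word_eval G h w = \<one> \<Longrightarrow> word_eq R w []"
  shows "presented_group R \<cong> subgroup_generated G (range h)"
proof -
  interpret P: group "presented_group R" by (rule group_presented_group)
  interpret S: group "subgroup_generated G (range h)" by (rule group_subgroup_generated)
  \<comment> \<open>The value is taken at an arbitrary representative; \<open>word_eval_cong\<close>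
    makes the choice irrelevant.\<close>
  define \<phi> where "\<phi> C = word_eval G h (SOME w. w \<in> C)" for C
  have \<phi>: "\<phi> (word_class R w) = word_eval G h w" for w
  proof -
    have "w \<in> word_class R w" by (simp add: word_class_def word_eq.refl)
    then have "(SOME v. v \<in> word_class R w) \<in> word_class R w" by (rule someI)
    then show ?thesis
      unfolding \<phi>_def using word_eval_cong[OF h R] by (force simp: word_class_def)
  qed
  have car: "carrier (presented_group R) = range (word_class R)"
    by (simp add: presented_group_def)
  have carS: "carrier (subgroup_generated G (range h)) = range (word_eval G h)"
    using h by (simp add: carrier_subgroup_generated word_eval_image Int_absorb1)
  have hom: "\<phi> \<in> hom (presented_group R) (subgroup_generated G (range h))"
    unfolding hom_def car carS
    by (auto simp: \<phi> presented_group_mult word_eval_append[OF h])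
  interpret \<phi>: group_hom "presented_group R" "subgroup_generated G (range h)" \<phi>
    by unfold_locales (rule hom)
  have "word_class R w = \<one>\<^bsub>presented_group R\<^esub>" if "\<phi> (word_class R w) = \<one>" for w
    using inj[of w] that by (simp add: \<phi> word_class_eq_iff presented_group_def)
  then have "inj_on \<phi> (carrier (presented_group R))"
    unfolding \<phi>.inj_on_one_iff unfolding car by auto
  moreover have "\<phi> ` carrier (presented_group R) = carrier (subgroup_generated G (range h))"
    by (simp add: car carS image_image \<phi>)
  ultimately have "\<phi> \<in> iso (presented_group R) (subgroup_generated G (range h))"
    using hom by (simp add: iso_def bij_betw_def)
  then show ?thesis by (auto simp: is_iso_def)
qed

end

lemma word_eq_context: "word_eq R u v \<Longrightarrow> word_eq R (p @ u @ q) (p @ v @ q)"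
  by (intro word_eq_append word_eq.refl)


section \<open>Words in the Higman--Thompson groups\<close>

text \<open>Letters \<open>(i, False)\<close> play the role of positive letters: in the realisation by
  homeomorphisms it is the inverses of the generators that move points to the right.\<close>

context
  fixes n :: nat
begin

abbreviation HT_eq (infix \<open>\<doteq>\<close> 50) where
  "u \<doteq> v \<equiv> word_eq (HT_relations n) u v"

lemma HT_swap_neg_pos:
  assumes "i < j"
  shows "[(i, False), (j, True)] \<doteq> [(j + n - 1, True), (i, False)]"
proof -
  have "[(i, False), (j, True), (i, True), (i, False)] \<doteq> [(i, False), (j, True)]"
    using word_eq.cancel[of _ "[(i, False), (j, True)]" i True "[]"] by simp
  moreover have "[(i, False), (j, True), (i, True), (i, False)] \<doteq> [(j + n - 1, True), (i, False)]"
    using word_eq.rel[of "[(i, False), (j, True), (i, True)]" "[(j + n - 1, True)]" _ "[]" "[(i, False)]"]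
      assms by (auto simp: HT_relations_def)
  ultimately show ?thesis by (blast intro: word_eq.trans word_eq.sym)
qed

text \<open>The word \<open>(?k, False) (i, False) (j, True) (j, False)\<close> is reduced in two
  ways: by cancelling the letters \<open>j\<close>, or by swapping the middle pair and cancelling
  the letters \<open>?k\<close>.\<close>

lemma HT_swap_neg_neg:
  assumes "i < j"
  shows "[(i, False), (j, False)] \<doteq> [(j + n - 1, False), (i, False)]"
proof -
  let ?k = "j + n - 1"
  have "[(?k, False), (i, False), (j, True), (j, False)]
      \<doteq> [(?k, False), (?k, True), (i, False), (j, False)]"
    using word_eq_context[OF HT_swap_neg_pos[OF assms], of "[(?k, False)]" "[(j, False)]"] by simp
  moreover have "[(?k, False), (i, False), (j, True), (j, False)] \<doteq> [(?k, False), (i, False)]"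
    using word_eq.cancel[of _ "[(?k, False), (i, False)]" j True "[]"] by simp
  moreover have "[(?k, False), (?k, True), (i, False), (j, False)] \<doteq> [(i, False), (j, False)]"
    using word_eq.cancel[of _ "[]" ?k False "[(i, False), (j, False)]"] by simp
  ultimately show ?thesis by (blast intro: word_eq.trans word_eq.sym)
qed

lemma HT_swap_pos_neg:
  assumes "i < j"
  shows "[(j, False), (i, True)] \<doteq> [(i, True), (j + n - 1, False)]"
proof -
  let ?k = "j + n - 1"
  have "[(i, True), (i, False), (j, False), (i, True)]
      \<doteq> [(i, True), (?k, False), (i, False), (i, True)]"
    using word_eq_context[OF HT_swap_neg_neg[OF assms], of "[(i, True)]" "[(i, True)]"] by simp
  moreover have "[(i, True), (?k, False), (i, False), (i, True)] \<doteq> [(i, True), (?k, False)]"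
    using word_eq.cancel[of _ "[(i, True), (?k, False)]" i False "[]"] by simp
  moreover have "[(i, True), (i, False), (j, False), (i, True)] \<doteq> [(j, False), (i, True)]"
    using word_eq.cancel[of _ "[]" i True "[(j, False), (i, True)]"] by simp
  ultimately show ?thesis by (blast intro: word_eq.trans word_eq.sym)
qed

text \<open>Each swap carries \<open>(i, False)\<close> one place to the right, unless it cancels. A
  swap may raise its index, so the induction is over all \<open>i\<close>.\<close>

lemma HT_move_letter:
  "\<exists>xs' ys. (i, False) # map (\<lambda>i. (i, True)) xs
     \<doteq> map (\<lambda>i. (i, True)) xs' @ map (\<lambda>i. (i, False)) ys"
proof (induction xs arbitrary: i)
  case Nil
  show ?case
    by (intro exI[of _ "[]"] exI[of _ "[i]"]) (simp add: word_eq.refl)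
next
  case (Cons j xs)
  let ?T = "map (\<lambda>i. (i, True))" and ?F = "map (\<lambda>i. (i, False))"
  have step: ?case if "[(i, False), (j, True)] \<doteq> [(j', True), (i', False)]" for i' j'
  proof -
    obtain xs' ys where "(i', False) # ?T xs \<doteq> ?T xs' @ ?F ys" using Cons by blast
    from word_eq_context[OF this, of "[(j', True)]" "[]"]
    have "[(j', True), (i', False)] @ ?T xs \<doteq> ?T (j' # xs') @ ?F ys" by simp
    moreover have "(i, False) # ?T (j # xs) \<doteq> [(j', True), (i', False)] @ ?T xs"
      using word_eq_context[OF that, of "[]" "?T xs"] by simp
    ultimately show ?thesis by (blast intro: word_eq.trans)
  qed
  consider "i < j" | "i = j" | "j < i" by linarith
  then show ?case
  proof cases
    case 2
    then have "(i, False) # ?T (j # xs) \<doteq> ?T xs @ ?F []"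
      using word_eq.cancel[of _ "[]" i False "?T xs"] by simp
    then show ?thesis by blast
  qed (use step HT_swap_neg_pos HT_swap_pos_neg in blast)+
qed

lemma HT_fraction:
  "\<exists>xs ys. w \<doteq> map (\<lambda>i. (i, True)) xs @ map (\<lambda>i. (i, False)) ys"
proof (induction w)
  case Nil
  show ?case by (intro exI[of _ "[]"]) (simp add: word_eq.refl)
next
  case (Cons l w)
  let ?T = "map (\<lambda>i. (i, True))" and ?F = "map (\<lambda>i. (i, False))"
  obtain i b where l: "l = (i, b)" by force
  obtain xs ys where "w \<doteq> ?T xs @ ?F ys" using Cons by blast
  from word_eq_context[OF this, of "[l]" "[]"]
  have w: "l # w \<doteq> l # ?T xs @ ?F ys" by simp
  show ?case
  proof (cases b)
    case True
    with w l have "l # w \<doteq> ?T (i # xs) @ ?F ys" by simp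
    then show ?thesis by blast
  next
    case False
    obtain xs' zs where "(i, False) # ?T xs \<doteq> ?T xs' @ ?F zs" using HT_move_letter by blast
    from word_eq_context[OF this, of "[]" "?F ys"] w l False
    have "l # w \<doteq> ?T xs' @ ?F (zs @ ys)" by (auto intro: word_eq.trans)
    then show ?thesis by blast
  qed
qed

lemma HT_shift:
  assumes "\<forall>i\<in>set u. k < i"
  shows "map (\<lambda>i. (i, False)) (k # u)
    \<doteq> map (\<lambda>i. (i, False)) (map (\<lambda>j. j + n - 1) u @ [k])"
  using assms
proof (induction u)
  case Nil
  show ?case by (simp add: word_eq.refl)
next
  case (Cons j u)
  let ?F = "map (\<lambda>i. (i, False))"
  have "[(k, False), (j, False)] @ ?F u \<doteq> [(j + n - 1, False), (k, False)] @ ?F u"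
    using Cons.prems by (intro word_eq_append HT_swap_neg_neg word_eq.refl) auto
  moreover have "[(j + n - 1, False)] @ ?F (k # u) @ []
    \<doteq> [(j + n - 1, False)] @ ?F (map (\<lambda>j. j + n - 1) u @ [k]) @ []"
    using Cons by (intro word_eq_context) auto
  ultimately show ?case by (auto intro: word_eq.trans)
qed

text \<open>Prepares one round of the induction in \<open>ev_pos_inject\<close>: the length equation
  and \<open>0 < p\<close> make \<open>u'\<close> shorter than \<open>u\<close> whenever
  \<open>k\<close> occurs in \<open>u\<close>. By \<open>n \<ge> 1\<close>, shifted indices stay
  above \<open>k\<close>.\<close>

lemma HT_collect:
  assumes "n \<ge> 1" "\<forall>i\<in>set u. k \<le> i"
  shows "\<exists>u' p. (\<forall>i\<in>set u'. k < i) \<and> length u = length u' + p \<and> (k \<in> set u \<longrightarrow> 0 < p) \<and>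
     map (\<lambda>i. (i, False)) u \<doteq> map (\<lambda>i. (i, False)) (u' @ replicate p k)"
  using assms(2)
proof (induction u)
  case Nil
  show ?case by (intro exI[of _ "[]"] exI[of _ 0]) (simp add: word_eq.refl)
next
  case (Cons i u)
  let ?F = "map (\<lambda>i. (i, False))"
  obtain u' p where u': "\<forall>i\<in>set u'. k < i" and p: "length u = length u' + p" "k \<in> set u \<longrightarrow> 0 < p"
    and eq: "?F u \<doteq> ?F (u' @ replicate p k)"
    using Cons by auto
  have eq': "?F (i # u) \<doteq> ?F (i # u' @ replicate p k)"
    using word_eq_context[OF eq, of "[(i, False)]" "[]"] by simp
  show ?case
  proof (cases "i = k")
    case True
    \<comment> \<open>The new \<open>k\<close> in front passes through \<open>u'\<close>, raising
      its indices, and joins the block at the end.\<close>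
    let ?v = "map (\<lambda>j. j + n - 1) u'"
    have "?F (k # u') @ ?F (replicate p k) \<doteq> ?F (?v @ [k]) @ ?F (replicate p k)"
      by (intro word_eq_append HT_shift word_eq.refl u')
    with eq' True have "?F (i # u) \<doteq> ?F (?v @ replicate (Suc p) k)"
      by (auto intro: word_eq.trans)
    moreover have "\<forall>i\<in>set ?v. k < i" using u' assms(1) by fastforce
    moreover have "length (i # u) = length ?v + Suc p" using p by simp
    ultimately show ?thesis by blast
  next
    case False
    then have "\<forall>j\<in>set (i # u'). k < j" "length (i # u) = length (i # u') + p"
      "k \<in> set (i # u) \<longrightarrow> 0 < p" using u' p Cons.prems by auto
    with eq' show ?thesis by (metis append_Cons)
  qed
qed

end


section \<open>Faithfulness of an action by homeomorphisms\<close>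

interpretation Homeo: group Homeo_plus
  by (rule group_Homeo_plus)

section \<open>Elementary facts about \<open>Homeo_plus\<close>\<close>

lemma Homeo_plus_mult [simp]: "f \<otimes>\<^bsub>Homeo_plus\<^esub> g = f \<circ> g"
  by (simp add: Homeo_plus_def)

lemma Homeo_plus_one [simp]: "\<one>\<^bsub>Homeo_plus\<^esub> = id"
  by (simp add: Homeo_plus_def)

lemma Homeo_plus_strict_mono: "f \<in> carrier Homeo_plus \<Longrightarrow> strict_mono f"
  by (simp add: Homeo_plus_def)

lemma Homeo_plus_continuous: "f \<in> carrier Homeo_plus \<Longrightarrow> continuous_on UNIV f"
  by (auto simp: Homeo_plus_def homeomorphism_def)

lemma Homeo_plus_comp: "f \<in> carrier Homeo_plus \<Longrightarrow> g \<in> carrier Homeo_plus \<Longrightarrow> f \<circ> g \<in> carrier Homeo_plus"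
  using Homeo.m_closed[of f g] by simp

lemma Homeo_plus_id: "id \<in> carrier Homeo_plus"
  using Homeo.one_closed by simp

lemma Homeo_plus_bij: "f \<in> carrier Homeo_plus \<Longrightarrow> bij f"
  by (auto simp: Homeo_plus_def homeomorphism_def bij_def strict_mono_imp_inj_on)

lemma Homeo_plus_inv_apply [simp]:
  assumes "f \<in> carrier Homeo_plus"
  shows "(inv\<^bsub>Homeo_plus\<^esub> f) (f x) = x" and "f ((inv\<^bsub>Homeo_plus\<^esub> f) x) = x"
  using fun_cong[OF Homeo.r_inv[OF assms], of x] fun_cong[OF Homeo.l_inv[OF assms], of x]
  by simp_all

lemma Homeo_plus_pow: "f [^]\<^bsub>Homeo_plus\<^esub> (N::nat) = f ^^ N"
proof (induction N)
  case (Suc N)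
  then show ?case using funpow_Suc_right[of N f] by simp
qed simp

text \<open>Abstracts what faithfulness needs: for \<open>k > 0\<close>, \<open>A k\<close> bounds
  the support of \<open>y k\<close> on the left. Index \<open>0\<close> is exempt, as the support of
  \<open>y 0\<close> may reach minus infinity.\<close>

locale shift_action =
  fixes n :: nat and y :: "nat \<Rightarrow> real \<Rightarrow> real" and A :: "nat \<Rightarrow> real"
  assumes n_ge_1: "n \<ge> 1"
    and y_carrier: "y k \<in> carrier Homeo_plus"
    and y_rel: "i < j \<Longrightarrow> y i \<circ> y j = y (j + n - 1) \<circ> y i"
    and A_mono: "0 < i \<Longrightarrow> i \<le> j \<Longrightarrow> A i \<le> A j"
    and y_fix: "0 < k \<Longrightarrow> x \<le> A k \<Longrightarrow> y k x = x"
    and y_move: "A (Suc k) < y k (A (Suc k))"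
begin

abbreviation "g \<equiv> \<lambda>k. inv\<^bsub>Homeo_plus\<^esub> y k"

abbreviation "ev \<equiv> word_eval Homeo_plus g"

abbreviation "pos \<equiv> map (\<lambda>i::nat. (i, False))"

section \<open>Evaluation of words in the maps \<open>g k\<close>\<close>

lemma g_carrier: "range g \<subseteq> carrier Homeo_plus"
  using y_carrier by auto

lemma inv_g [simp]: "inv\<^bsub>Homeo_plus\<^esub> g k = y k"
  by (simp add: y_carrier)

lemma ev_append: "ev (u @ v) = ev u \<circ> ev v"
  by (simp add: Homeo.word_eval_append[OF g_carrier])

lemma ev_relation:
  assumes "(l, r) \<in> HT_relations n"
  shows "ev l = ev r"
proof -
  obtain i j where lr: "l = [(i, False), (j, True), (i, True)]" "r = [(j + n - 1, True)]"
    and "i < j" using assms by (auto simp: HT_relations_def)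
  let ?k = "j + n - 1"
  \<comment> \<open>Inverting \<open>y_rel\<close> reverses both products, which turns it into the
    relation for the \<open>g k\<close>.\<close>
  have "inv\<^bsub>Homeo_plus\<^esub> (y i \<otimes>\<^bsub>Homeo_plus\<^esub> y j) = inv\<^bsub>Homeo_plus\<^esub> (y ?k \<otimes>\<^bsub>Homeo_plus\<^esub> y i)"
    using y_rel[OF \<open>i < j\<close>] by simp
  then have "g j \<otimes>\<^bsub>Homeo_plus\<^esub> g i = g i \<otimes>\<^bsub>Homeo_plus\<^esub> g ?k"
    by (simp only: Homeo.inv_mult_group y_carrier)
  then have "g j \<circ> g i = g i \<circ> g ?k" by simp
  then have "y i \<circ> (g j \<circ> g i) = (y i \<circ> g i) \<circ> g ?k"
    by (simp add: o_assoc)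
  also have "y i \<circ> g i = id"
    using Homeo.r_inv[OF y_carrier, of i] by simp
  finally show ?thesis by (simp add: lr fun_eq_iff)
qed

lemma ev_cong: "word_eq (HT_relations n) u v \<Longrightarrow> ev u = ev v"
  using Homeo.word_eval_cong[OF g_carrier ev_relation] .

lemma ev_pos_fix:
  assumes "\<forall>i\<in>set u. k < i" "x \<le> A (Suc k)"
  shows "ev (pos u) x = x"
  using assms(1)
proof (induction u)
  case (Cons i u)
  then have "x \<le> A i" using assms(2) A_mono[of "Suc k" i] by auto
  with Cons show ?case by (simp add: y_fix)
qed simp

lemma ev_pos_replicate: "ev (pos (replicate p k)) = y k ^^ p"
  by (induction p) simp_all

lemma y_pow_move: "A (Suc k) \<le> x \<Longrightarrow> 0 < d \<Longrightarrow> A (Suc k) < (y k ^^ d) x"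
proof (induction d)
  case (Suc d)
  have "A (Suc k) \<le> (y k ^^ d) x"
    using Suc by (cases d) auto
  then have "y k (A (Suc k)) \<le> y k ((y k ^^ d) x)"
    using strict_mono_less_eq[OF Homeo_plus_strict_mono[OF y_carrier]] by blast
  with y_move[of k] show ?case by simp
qed simp

text \<open>The two maps are compared at the point that \<open>y k ^^ q\<close> carries to \<open>A (Suc k)\<close>.\<close>

lemma exponent_le:
  assumes "\<forall>i\<in>set u. k < i" "\<forall>i\<in>set v. k < i"
    and eq: "ev (pos u) \<circ> (y k ^^ p) = ev (pos v) \<circ> (y k ^^ q)"
  shows "q \<le> p"
proof (rule ccontr)
  assume "\<not> q \<le> p"
  then obtain d where d: "q = d + p" "0 < d"
    by (metis add.commute less_imp_add_positive not_le)
  have "surj (y k ^^ q)"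
    using Homeo_plus_bij[OF y_carrier[of k]] by (meson bij_is_surj surj_fn)
  then obtain t where t: "(y k ^^ q) t = A (Suc k)" by (metis surjD)
  define s where "s = (y k ^^ p) t"
  have s: "(y k ^^ d) s = A (Suc k)"
    using t d by (simp add: s_def funpow_add)
  \<comment> \<open>Powers of \<open>y k\<close> push every point from \<open>A (Suc k)\<close> on
    strictly past it, so \<open>s\<close> lies to the left, where \<open>ev (pos u)\<close> is the
    identity.\<close>
  then have "s < A (Suc k)"
    using y_pow_move[of k s d] d(2) by force
  moreover from this have "ev (pos u) s = s"
    using ev_pos_fix[OF assms(1), of s] by simp
  moreover have "ev (pos u) s = A (Suc k)"
    using fun_cong[OF eq, of t] t ev_pos_fix[OF assms(2), of "A (Suc k)"] by (simp add: s_def)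
  ultimately show False by simp
qed

lemma ev_pos_inject: "ev (pos u) = ev (pos v) \<Longrightarrow> word_eq (HT_relations n) (pos u) (pos v)"
proof (induction "length u + length v" arbitrary: u v rule: less_induct)
  case less
  show ?case
  proof (cases "u @ v = []")
    case True
    then show ?thesis by (simp add: word_eq.refl)
  next
    case False
    define k where "k = Min (set (u @ v))"
    have "k \<in> set (u @ v)" using False unfolding k_def by (intro Min_in) auto
    have ku: "\<forall>i\<in>set u. k \<le> i" and kv: "\<forall>i\<in>set v. k \<le> i"
      using False by (auto simp: k_def)
    obtain u' p where u': "\<forall>i\<in>set u'. k < i" "length u = length u' + p" "k \<in> set u \<longrightarrow> 0 < p"
      and equ: "word_eq (HT_relations n) (pos u) (pos (u' @ replicate p k))"
      using HT_collect[OF n_ge_1 ku] by blast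
    obtain v' q where v': "\<forall>i\<in>set v'. k < i" "length v = length v' + q" "k \<in> set v \<longrightarrow> 0 < q"
      and eqv: "word_eq (HT_relations n) (pos v) (pos (v' @ replicate q k))"
      using HT_collect[OF n_ge_1 kv] by blast
    have "ev (pos (u' @ replicate p k)) = ev (pos (v' @ replicate q k))"
      using ev_cong[OF equ] ev_cong[OF eqv] less.prems by simp
    then have eq: "ev (pos u') \<circ> (y k ^^ p) = ev (pos v') \<circ> (y k ^^ q)"
      unfolding map_append ev_append ev_pos_replicate .
    have "p = q"
      using exponent_le[OF u'(1) v'(1) eq] exponent_le[OF v'(1) u'(1) eq[symmetric]] by simp
    moreover have "surj (y k ^^ p)"
      using Homeo_plus_bij[OF y_carrier[of k]] by (meson bij_is_surj surj_fn)
    ultimately have "ev (pos u') = ev (pos v')"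
      using eq by (metis surj_fun_eq)
    \<comment> \<open>The least letter \<open>k\<close> occurs in \<open>u\<close> or
      \<open>v\<close>, so the common exponent \<open>p = q\<close> is positive.\<close>
    moreover have "length u' + length v' < length u + length v"
      using \<open>k \<in> set (u @ v)\<close> u'(2,3) v'(2,3) \<open>p = q\<close> by auto
    ultimately have "word_eq (HT_relations n) (pos u') (pos v')"
      using less.hyps by blast
    then have "word_eq (HT_relations n) (pos (u' @ replicate p k)) (pos (v' @ replicate q k))"
      using \<open>p = q\<close> by (auto intro: word_eq_append word_eq.refl)
    then show ?thesis
      using equ eqv by (blast intro: word_eq.trans word_eq.sym)
  qed
qed

text \<open>The \<open>True\<close> part of a fraction evaluates to the inverse of
  \<open>ev (pos (rev xs))\<close>. If the fraction is trivial, \<open>ev_pos_inject\<close> lets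
  \<open>rev xs\<close> replace \<open>ys\<close>, after which everything cancels freely.\<close>

lemma ev_trivial:
  assumes "ev w = id"
  shows "word_eq (HT_relations n) w []"
proof -
  obtain xs ys where w: "word_eq (HT_relations n) w (map (\<lambda>i. (i, True)) xs @ pos ys)"
    using HT_fraction by blast
  have ev: "ev (pos u) \<in> carrier Homeo_plus" for u
    by (rule Homeo.word_eval_closed[OF g_carrier])
  have "inv\<^bsub>Homeo_plus\<^esub> (ev (pos (rev xs))) \<otimes>\<^bsub>Homeo_plus\<^esub> ev (pos ys) = \<one>\<^bsub>Homeo_plus\<^esub>"
    using ev_cong[OF w] assms
    by (simp add: ev_append Homeo.word_eval_inverse[OF g_carrier])
  then have "ev (pos ys) = ev (pos (rev xs))"
    using ev by (metis Homeo.inv_closed Homeo.inv_equality Homeo.inv_inv Homeo.inv_comm)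
  then have "word_eq (HT_relations n) (map (\<lambda>i. (i, True)) xs @ pos ys)
      (map (\<lambda>i. (i, True)) xs @ pos (rev xs))"
    by (intro word_eq_append word_eq.refl ev_pos_inject)
  moreover have "word_eq (HT_relations n) (map (\<lambda>i. (i, True)) xs @ pos (rev xs)) []"
  proof (induction xs rule: rev_induct)
    case (snoc i xs)
    have "word_eq (HT_relations n) (map (\<lambda>i. (i, True)) (xs @ [i]) @ pos (rev (xs @ [i])))
        (map (\<lambda>i. (i, True)) xs @ pos (rev xs))"
      using word_eq.cancel[of _ "map (\<lambda>i. (i, True)) xs" i True "pos (rev xs)"] by simp
    then show ?case using snoc by (rule word_eq.trans)
  qed (simp add: word_eq.refl)
  ultimately show ?thesis using w by (blast intro: word_eq.trans)
qed

proposition Higman_Thompson_iso: "Higman_Thompson n \<cong> subgroup_generated Homeo_plus (range g)"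
  unfolding Higman_Thompson_def
  using Homeo.presented_group_iso[OF g_carrier ev_relation] ev_trivial by simp

end


section \<open>Chains of homeomorphisms that move fast\<close>

text \<open>The composite \<open>h (j + d) \<circ> ... \<circ> h (j + 1)\<close>, with the smallest
  index acting first.\<close>

primrec segment :: "(nat \<Rightarrow> 'a \<Rightarrow> 'a) \<Rightarrow> nat \<Rightarrow> nat \<Rightarrow> 'a \<Rightarrow> 'a" where
  "segment h j 0 = id"
| "segment h j (Suc d) = h (j + d + 1) \<circ> segment h j d"

lemma segment_add: "segment h j (d + e) = segment h (j + d) e \<circ> segment h j d"
  by (induction e) (simp_all add: o_assoc add.assoc)

text \<open>Index \<open>0\<close> is exempt from the shift rule: the value at \<open>n - 1\<close> is \<open>c (n - 1)\<close>, not \<open>F (c 0)\<close>.\<close>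

function extend :: "nat \<Rightarrow> ('a \<Rightarrow> 'a) \<Rightarrow> (nat \<Rightarrow> 'a) \<Rightarrow> nat \<Rightarrow> 'a" where
  "extend n F c m = (if m < n \<or> n \<le> 1 then c m else F (extend n F c (m - (n - 1))))"
  by auto
termination by (relation "Wellfounded.measure (\<lambda>(n, F, c, m). m)") auto

declare extend.simps [simp del]

lemma extend_base: "m < n \<Longrightarrow> extend n F c m = c m"
  by (simp add: extend.simps)

lemma extend_shift: "2 \<le> n \<Longrightarrow> 0 < m \<Longrightarrow> extend n F c (m + n - 1) = F (extend n F c m)"
  by (subst extend.simps) auto

text \<open>Every positive index arises from one in \<open>{1..<n}\<close> by repeatedly adding
  \<open>n - 1\<close>.\<close>

lemma shift_induct [consumes 2, case_names base shift]:
  fixes m n :: nat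
  assumes "2 \<le> n" "0 < m"
    and "\<And>m. 0 < m \<Longrightarrow> m < n \<Longrightarrow> Q m" and "\<And>m. 0 < m \<Longrightarrow> Q m \<Longrightarrow> Q (m + n - 1)"
  shows "Q m"
  using assms(2)
proof (induction m rule: less_induct)
  case (less m)
  show ?case
  proof (cases "m < n")
    case False
    then have "Q (m - (n - 1))" using less assms(1) by auto
    with False assms(1) assms(4)[of "m - (n - 1)"] show ?thesis by simp
  qed (use less assms(3) in auto)
qed

text \<open>Both maps fix \<open>c\<close>, so by monotonicity they preserve the two half-lines at
  \<open>c\<close>; on each of these one of them is the identity.\<close>

lemma strict_mono_commute:
  fixes u v :: "'a::linorder \<Rightarrow> 'a"
  assumes "strict_mono u" "strict_mono v"
    and u: "\<And>x. c \<le> x \<Longrightarrow> u x = x" and v: "\<And>x. x \<le> c \<Longrightarrow> v x = x"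
  shows "u (v x) = v (u x)"
proof (cases "x \<le> c")
  case True
  then have "u x \<le> u c" using strict_mono_less_eq[OF assms(1)] by blast
  with True show ?thesis by (simp add: u v)
next
  case False
  then have "v c \<le> v x" using strict_mono_less_eq[OF assms(2)] by auto
  with False show ?thesis by (simp add: u v)
qed

text \<open>The numbers \<open>a i\<close> and \<open>b i\<close> stand for the endpoints of the
  support of \<open>h i\<close>. Only \<open>a 2, ..., a n\<close> and
  \<open>b 1, ..., b (n - 1)\<close> are constrained, since the outer endpoints may be infinite. The
  size of the power enters through \<open>fast\<close>.\<close>

locale fast_chain =
  fixes n :: nat and h :: "nat \<Rightarrow> real \<Rightarrow> real" and a b :: "nat \<Rightarrow> real"
  assumes n_ge_2: "2 \<le> n"
    and h_carrier: "i \<in> {1..n} \<Longrightarrow> h i \<in> carrier Homeo_plus"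
    and h_ge: "i \<in> {1..n} \<Longrightarrow> x \<le> h i x"
    and h_fix_left: "i \<in> {2..n} \<Longrightarrow> x \<le> a i \<Longrightarrow> h i x = x"
    and h_fix_right: "i \<in> {1..<n} \<Longrightarrow> b i \<le> x \<Longrightarrow> h i x = x"
    and h_move: "i \<in> {1..<n} \<Longrightarrow> a (i + 1) < h i (a (i + 1))"
    and overlap: "i \<in> {1..<n} \<Longrightarrow> a (i + 1) < b i"
    and disjoint: "1 \<le> i \<Longrightarrow> i + 2 \<le> n \<Longrightarrow> b i \<le> a (i + 2)"
    and fast: "b (n - 1) \<le> segment h 0 n (a 2)"
begin

definition P :: "real \<Rightarrow> real" where "P = segment h 0 n"

abbreviation P' :: "real \<Rightarrow> real" where "P' \<equiv> inv\<^bsub>Homeo_plus\<^esub> P"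

definition y :: "nat \<Rightarrow> real \<Rightarrow> real" where
  "y = extend n (\<lambda>u. P \<circ> u \<circ> P') (\<lambda>j. segment h j (n - j))"

text \<open>Among the factors of \<open>y j\<close> with \<open>0 < j < n\<close>, the map
  \<open>h (j + 1)\<close> has the leftmost support, and conjugation by \<open>P\<close> moves
  supports by \<open>P\<close>.\<close>

definition A :: "nat \<Rightarrow> real" where
  "A = extend n P (\<lambda>j. a (j + 1))"

text \<open>The value \<open>b (i - 1)\<close> separates the two sides.\<close>

lemma a_less: "2 \<le> i \<Longrightarrow> i < n \<Longrightarrow> a i < a (i + 1)"
  using overlap[of "i - 1"] disjoint[of "i - 1"] by force

lemma a_mono: "i \<le> j \<Longrightarrow> 2 \<le> i \<Longrightarrow> j \<le> n \<Longrightarrow> a i \<le> a j"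
proof (induction j rule: dec_induct)
  case (step j)
  then show ?case using a_less[of j] by simp
qed simp

lemma b_mono: "i \<le> j \<Longrightarrow> 1 \<le> i \<Longrightarrow> j < n \<Longrightarrow> b i \<le> b j"
proof (induction j rule: dec_induct)
  case (step j)
  then show ?case using disjoint[of j] overlap[of "j + 1"] by force
qed simp

section \<open>Supports of the segments\<close>

lemma segment_carrier: "j + d \<le> n \<Longrightarrow> segment h j d \<in> carrier Homeo_plus"
  by (induction d) (auto intro!: Homeo_plus_comp h_carrier Homeo_plus_id)

lemma segment_ge: "j + d \<le> n \<Longrightarrow> x \<le> segment h j d x"
proof (induction d)
  case (Suc d)
  then show ?case using h_ge[of "j + d + 1" "segment h j d x"] by simp
qed simp

lemma segment_fix_left: "1 \<le> j \<Longrightarrow> j + d \<le> n \<Longrightarrow> x \<le> a (j + 1) \<Longrightarrow> segment h j d x = x"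
proof (induction d)
  case (Suc d)
  then show ?case using h_fix_left[of "j + d + 1" x] a_mono[of "j + 1" "j + d + 1"] by simp
qed simp

lemma segment_fix_right: "d \<le> i \<Longrightarrow> i < n \<Longrightarrow> b i \<le> x \<Longrightarrow> segment h 0 d x = x"
proof (induction d)
  case (Suc d)
  then show ?case using h_fix_right[of "d + 1" x] b_mono[of "d + 1" i] by simp
qed simp

lemma P_carrier: "P \<in> carrier Homeo_plus"
  unfolding P_def by (rule segment_carrier) simp

lemmas P_inverse [simp] = Homeo_plus_inv_apply[OF P_carrier]

lemma P_less [simp]: "P x < P z \<longleftrightarrow> x < z" and P_le [simp]: "P x \<le> P z \<longleftrightarrow> x \<le> z"
  using Homeo_plus_strict_mono[OF P_carrier]
  by (simp_all add: strict_mono_less strict_mono_less_eq)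

section \<open>The maps \<open>y j\<close> and the bounds \<open>A j\<close>\<close>

lemma y_base: "j < n \<Longrightarrow> y j = segment h j (n - j)"
  by (simp add: y_def extend_base)

lemma y_last: "y (n - 1) = h n"
proof -
  have "n - (n - 1) = Suc 0" "n - 1 < n" using n_ge_2 by auto
  then show ?thesis using y_base[of "n - 1"] by simp
qed

lemma y_step:
  assumes "Suc k < n"
  shows "y k = y (Suc k) \<circ> h (Suc k)"
proof -
  have "n - k = 1 + (n - Suc k)" using assms by simp
  then have "segment h k (n - k) = segment h (k + 1) (n - Suc k) \<circ> segment h k 1"
    by (simp only: segment_add)
  then show ?thesis using assms by (simp add: y_base)
qed

lemma y_shift: "0 < j \<Longrightarrow> y (j + n - 1) = P \<circ> y j \<circ> P'"
  using n_ge_2 by (simp only: y_def extend_shift)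

lemma y_split: "j < n \<Longrightarrow> P = y j \<circ> segment h 0 j"
  using segment_add[of h 0 j "n - j"] by (simp add: P_def y_base)

lemma y_carrier: "y j \<in> carrier Homeo_plus"
proof (cases "j = 0")
  case True
  then show ?thesis using n_ge_2 by (simp add: y_base segment_carrier)
next
  case False
  then have "0 < j" by simp
  with n_ge_2 show ?thesis
  proof (induction j rule: shift_induct)
    case (shift j)
    then show ?case
      using Homeo.inv_closed[OF P_carrier] by (simp only: y_shift Homeo_plus_comp P_carrier)
  qed (simp add: y_base segment_carrier)
qed

lemma A_base: "j < n \<Longrightarrow> A j = a (j + 1)"
  by (simp add: A_def extend_base)

lemma A_shift: "0 < j \<Longrightarrow> A (j + n - 1) = P (A j)"
  using n_ge_2 by (simp only: A_def extend_shift)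

lemma A_n: "A n = P (a 2)"
  using A_shift[of 1] n_ge_2 by (simp add: A_base numeral_2_eq_2)

lemma b_le_A_n: "b (n - 1) \<le> A n"
  using fast by (simp add: A_n P_def)

lemma A_less: "0 < k \<Longrightarrow> A k < A (Suc k)"
  using n_ge_2
proof (induction k rule: shift_induct[of n, consumes 2])
  case (base k)
  show ?case
  proof (cases "Suc k = n")
    \<comment> \<open>At this seam between the two rules for \<open>A\<close>, speed is needed:
      \<open>a n < b (n - 1) \<le> P (a 2) = A n\<close>.\<close>
    case True
    then show ?thesis
      using overlap[of k] b_le_A_n base by (auto simp: A_base)
  next
    case False
    then show ?thesis using base a_less[of "k + 1"] by (simp add: A_base)
  qed
next
  case (shift k)
  have "Suc (k + n - 1) = Suc k + n - 1" using n_ge_2 by simp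
  then show ?case using shift A_shift[of k] A_shift[of "Suc k"] by simp
qed

lemma A_mono: "0 < i \<Longrightarrow> i \<le> j \<Longrightarrow> A i \<le> A j"
proof (rotate_tac 1, induction j rule: dec_induct)
  case (step j)
  then show ?case using A_less[of j] by simp
qed simp

lemma y_fix: "0 < k \<Longrightarrow> x \<le> A k \<Longrightarrow> y k x = x"
  using n_ge_2
proof (induction k arbitrary: x rule: shift_induct[of n, consumes 2])
  case (base k)
  then show ?case by (simp add: y_base A_base segment_fix_left)
next
  case (shift k)
  have "P (P' x) \<le> P (A k)" using shift A_shift by simp
  then have "P' x \<le> A k" by (simp only: P_le)
  then have "y k (P' x) = P' x" using shift by simp
  then show ?case using shift y_shift by simp
qed

lemma y_move: "A (Suc k) < y k (A (Suc k))"
proof -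
  have base: "A (Suc k) < y k (A (Suc k))" if "k < n" for k
  proof (cases "Suc k = n")
    case True
    \<comment> \<open>\<open>w\<close> is \<open>P (a 2)\<close> before \<open>h n\<close> is
      applied, so \<open>A n = h n w\<close>. As \<open>h 1, ..., h (n - 1)\<close> fix
      \<open>b (n - 1)\<close>, we get \<open>w < b (n - 1) \<le> A n\<close>; applying
      \<open>h n\<close> gives the claim.\<close>
    define w where "w = segment h 0 k (a 2)"
    have k: "1 \<le> k" "k = n - 1" using True n_ge_2 by auto
    have hn: "h n \<in> carrier Homeo_plus" using h_carrier n_ge_2 by simp
    have y: "y k = h n" using y_last k(2) by simp
    have A: "A (Suc k) = h n w"
      using segment.simps(2)[of h 0 k] True by (simp add: A_n P_def w_def)
    have "a 2 < b k"
      using overlap[of k] a_mono[of 2 "k + 1"] k True by auto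
    then have "w < segment h 0 k (b k)"
      unfolding w_def using Homeo_plus_strict_mono[OF segment_carrier[of 0 k]] that
      by (simp add: strict_mono_less)
    then have "w < A (Suc k)"
      using segment_fix_right[of k k "b k"] that b_le_A_n True k by simp
    then have "h n w < h n (A (Suc k))"
      using Homeo_plus_strict_mono[OF hn] by (simp add: strict_mono_less)
    with A y show ?thesis by simp
  next
    case False
    with that have k: "Suc k < n" by simp
    \<comment> \<open>The first factor already moves \<open>a (k + 2)\<close>, and the later ones
      never move a point to the left.\<close>
    have "y k = segment h (Suc k) (n - Suc k) \<circ> h (Suc k)"
      using k y_step by (simp add: y_base)
    moreover have "a (k + 2) < h (Suc k) (a (k + 2))"
      using h_move[of "Suc k"] k by simp
    moreover have "h (Suc k) (a (k + 2)) \<le> segment h (Suc k) (n - Suc k) (h (Suc k) (a (k + 2)))"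
      by (rule segment_ge) (use k in simp)
    ultimately show ?thesis using k by (simp add: A_base)
  qed
  show ?thesis
  proof (cases "k = 0")
    case True
    then show ?thesis using base n_ge_2 by simp
  next
    case False
    then have "0 < k" by simp
    with n_ge_2 show ?thesis
    proof (induction k rule: shift_induct)
      case (shift k)
      have "Suc (k + n - 1) = Suc k + n - 1" using n_ge_2 by simp
      then show ?case using shift A_shift[of "Suc k"] y_shift[of k] by simp
    qed (use base in simp)
  qed
qed

text \<open>The two supports are separated, by \<open>b i \<le> A (Suc i) \<le> A j\<close>; for
  \<open>i = n - 1\<close> this uses \<open>b_le_A_n\<close>.\<close>

lemma segment_commute:
  assumes "i < n" "i < j"
  shows "segment h 0 i (y j x) = y j (segment h 0 i x)"
proof (cases "i = 0")
  case False
  have "b i \<le> A (Suc i)"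
  proof (cases "Suc i = n")
    case True
    then show ?thesis using b_le_A_n by auto
  next
    case False
    then show ?thesis using \<open>i \<noteq> 0\<close> assms disjoint[of i] by (simp add: A_base)
  qed
  also have "\<dots> \<le> A j" using assms by (intro A_mono) auto
  finally have "b i \<le> A j" .
  show ?thesis
  proof (rule strict_mono_commute[where c = "A j"])
    show "strict_mono (segment h 0 i)" "strict_mono (y j)"
      using assms by (simp_all add: Homeo_plus_strict_mono segment_carrier y_carrier)
    show "segment h 0 i x = x" if "A j \<le> x" for x
      using segment_fix_right[of i i x] \<open>b i \<le> A j\<close> assms that by simp
    show "y j x = x" if "x \<le> A j" for x
      using y_fix[of j x] assms that by simp
  qed
qed simp

lemma y_rel: "i < j \<Longrightarrow> y i \<circ> y j = y (j + n - 1) \<circ> y i"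
proof -
  have base: "y i \<circ> y j = y (j + n - 1) \<circ> y i" if "i < n" "i < j" for i j
  proof
    fix x
    \<comment> \<open>By \<open>y_split\<close>, \<open>w\<close> is the point that
      \<open>segment h 0 i\<close> carries to \<open>x\<close>.\<close>
    define w where "w = P' (y i x)"
    have "y i (segment h 0 i w) = y i x"
      using fun_cong[OF y_split[OF \<open>i < n\<close>], of w] by (simp add: w_def)
    then have w: "segment h 0 i w = x"
      using Homeo_plus_bij[OF y_carrier[of i]] by (simp add: bij_def inj_eq)
    have "(y (j + n - 1) \<circ> y i) x = P (y j w)"
      using that y_shift[of j] by (simp add: w_def)
    also have "\<dots> = y i (y j x)"
      using fun_cong[OF y_split[OF \<open>i < n\<close>], of "y j w"] segment_commute[OF that, of w] w by simp
    finally show "(y i \<circ> y j) x = (y (j + n - 1) \<circ> y i) x" by simp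
  qed
  assume "i < j"
  show ?thesis
  proof (cases "i = 0")
    case True
    then show ?thesis using base \<open>i < j\<close> n_ge_2 by simp
  next
    case False
    then have "0 < i" by simp
    with n_ge_2 show ?thesis using \<open>i < j\<close>
    proof (induction i arbitrary: j rule: shift_induct)
      case (shift i)
      \<comment> \<open>Both indices are now shifts, so the relation is the conjugate by
        \<open>P\<close> of the one for \<open>i\<close> and \<open>j0\<close>.\<close>
      define j0 where "j0 = j - (n - 1)"
      have j: "j = j0 + n - 1" and "i < j0" "0 < j0"
        using shift n_ge_2 by (auto simp: j0_def)
      have rel: "y i (y j0 x) = y j (y i x)" for x
        using fun_cong[OF shift.IH[OF \<open>i < j0\<close>], of x] j by simp
      have yj: "P' (y j x) = y j0 (P' x)" for x
        using y_shift[OF \<open>0 < j0\<close>] j by simp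
      have "0 < j" using \<open>i < j0\<close> n_ge_2 j by simp
      show ?case
      proof
        fix x
        show "(y (i + n - 1) \<circ> y j) x = (y (j + n - 1) \<circ> y (i + n - 1)) x"
          unfolding y_shift[OF \<open>0 < i\<close>] y_shift[OF \<open>0 < j\<close>] by (simp add: yj rel)
      qed
    qed (use base in blast)
  qed
qed

section \<open>Generators and isomorphism type of a fast chain\<close>

sublocale shift_action n y A
proof unfold_locales
  show "1 \<le> n" using n_ge_2 by simp
qed (rule y_carrier y_rel A_mono y_fix y_move; assumption)+

text \<open>The \<open>y j\<close> are built from the \<open>h i\<close>; conversely
  \<open>h n = y (n - 1)\<close>, and \<open>h i = g i \<circ> y (i - 1)\<close> for
  \<open>i < n\<close>.\<close>

lemma generate_g: "generate Homeo_plus (range g) = generate Homeo_plus (h ` {1..n})"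
proof
  let ?H = "generate Homeo_plus (h ` {1..n})" and ?K = "generate Homeo_plus (range g)"
  have hc: "h ` {1..n} \<subseteq> carrier Homeo_plus" using h_carrier by blast
  interpret H: subgroup ?H Homeo_plus by (rule Homeo.generate_is_subgroup[OF hc])
  interpret K: subgroup ?K Homeo_plus by (rule Homeo.generate_is_subgroup[OF g_carrier])
  have comp: "u \<circ> v \<in> L" if "subgroup L Homeo_plus" "u \<in> L" "v \<in> L" for u v L
    using subgroup.m_closed[OF that] by simp
  have seg: "segment h j d \<in> ?H" if "j + d \<le> n" for j d
    using that
  proof (induction d)
    case (Suc d)
    then have "h (j + d + 1) \<in> ?H" by (intro generate.incl imageI) auto
    moreover have "segment h j d \<in> ?H" using Suc by simp
    ultimately show ?case
      unfolding segment.simps by (rule comp[OF H.subgroup_axioms])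
  qed (use H.one_closed in simp)
  have P: "P \<in> ?H" unfolding P_def by (rule seg) simp
  have P': "P' \<in> ?H" using P by (rule H.m_inv_closed)
  have y: "y j \<in> ?H" for j
  proof (cases "j = 0")
    case True
    then show ?thesis using n_ge_2 seg by (simp add: y_base)
  next
    case False
    then have "0 < j" by simp
    with n_ge_2 show ?thesis
    proof (induction j rule: shift_induct)
      case (base j)
      then show ?case unfolding y_base[OF \<open>j < n\<close>] by (intro seg) simp
    next
      case (shift j)
      then show ?case
        unfolding y_shift[OF \<open>0 < j\<close>] by (intro comp[OF H.subgroup_axioms] P P')
    qed
  qed
  then have "range g \<subseteq> ?H" using H.m_inv_closed by blast
  then show "?K \<subseteq> ?H"
    by (rule Homeo.generate_subgroup_incl) (rule H.subgroup_axioms)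
  have yK: "y j \<in> ?K" for j
    using K.m_inv_closed[OF generate.incl[of "g j"]] by simp
  have "h i \<in> ?K" if "i \<in> {1..n}" for i
  proof (cases "i = n")
    case True
    then show ?thesis using yK[of "n - 1"] y_last by simp
  next
    case False
    then have i: "1 \<le> i" "i < n" using that by auto
    have "y (i - 1) = y i \<circ> h i"
      using y_step[of "i - 1"] i by simp
    then have "g i \<circ> y (i - 1) = (g i \<circ> y i) \<circ> h i" by (simp add: o_assoc)
    also have "g i \<circ> y i = id" using Homeo.l_inv[OF y_carrier, of i] by simp
    finally have "h i = g i \<circ> y (i - 1)" by (simp add: fun_eq_iff)
    moreover have "g i \<in> ?K" by (rule generate.incl) simp
    ultimately show ?thesis using comp[OF K.subgroup_axioms] yK by metis
  qed
  then show "?H \<subseteq> ?K"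
    by (intro Homeo.generate_subgroup_incl K.subgroup_axioms) blast
qed

theorem subgroup_generated_iso: "subgroup_generated Homeo_plus (h ` {1..n}) \<cong> Higman_Thompson n"
proof -
  have "h ` {1..n} \<subseteq> carrier Homeo_plus" using h_carrier by blast
  then have "subgroup_generated Homeo_plus (range g) = subgroup_generated Homeo_plus (h ` {1..n})"
    using g_carrier by (simp add: subgroup_generated_def generate_g Int_absorb1)
  then show ?thesis
    using Higman_Thompson_iso group.iso_sym[of "Higman_Thompson n"] group_presented_group
    by (metis Higman_Thompson_def)
qed

end

section \<open>Powers of the generators of a chain group\<close>

text \<open>An orbit staying below \<open>w\<close> would increase to a fixed point between
  \<open>z\<close> and \<open>w\<close>, hence inside the support.\<close>

lemma iterates_eventually_ge:
  fixes f :: "real \<Rightarrow> real"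
  assumes cont: "continuous_on UNIV f" and ge: "\<And>x. x \<le> f x"
    and J: "is_interval (supp f)" "z \<in> supp f" "w \<in> supp f"
  shows "\<forall>\<^sub>F N in sequentially. w \<le> (f ^^ N) z"
proof -
  have inc: "incseq (\<lambda>N. (f ^^ N) z)"
    by (rule incseq_SucI) (simp add: ge)
  have "\<exists>N. w \<le> (f ^^ N) z"
  proof (rule ccontr)
    assume "\<nexists>N. w \<le> (f ^^ N) z"
    then have less: "(f ^^ N) z \<le> w" for N by (meson le_cases)
    obtain L where L: "(\<lambda>N. (f ^^ N) z) \<longlonglongrightarrow> L" and le: "\<And>N. (f ^^ N) z \<le> L"
      using incseq_convergent[OF inc] less by blast
    have "(\<lambda>N. f ((f ^^ N) z)) \<longlonglongrightarrow> f L"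
      using continuous_on_tendsto_compose[OF cont L] by simp
    moreover have "(\<lambda>N. f ((f ^^ N) z)) \<longlonglongrightarrow> L"
      using LIMSEQ_Suc[OF L] by simp
    ultimately have "f L = L" by (rule LIMSEQ_unique)
    moreover have "z \<le> L" "L \<le> w" using le[of 0] LIMSEQ_le_const2[OF L] less by auto
    then have "L \<in> supp f" using J by (meson mem_is_interval_1_I)
    ultimately show False by (simp add: supp_def)
  qed
  then obtain N0 where "w \<le> (f ^^ N0) z" by blast
  then show ?thesis
    unfolding eventually_sequentially using inc by (meson incseqD order_trans)
qed

text \<open>Openness keeps the endpoints outside \<open>J\<close>; convexity puts everything between
  them inside.\<close>

lemma open_interval_endpoints:
  assumes "open J" "is_interval J"
  shows "x \<in> J \<longleftrightarrow> left_endpoint J < ereal x \<and> ereal x < (SUP x\<in>J. ereal x)"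
proof
  assume "x \<in> J"
  then obtain e where e: "0 < e" "\<And>z. dist z x < e \<Longrightarrow> z \<in> J"
    using assms(1) by (auto simp: open_dist)
  have "x - e / 2 \<in> J" "x + e / 2 \<in> J" using e by (auto simp: dist_real_def)
  then have "left_endpoint J \<le> ereal (x - e / 2)" "ereal (x + e / 2) \<le> (SUP x\<in>J. ereal x)"
    unfolding left_endpoint_def by (auto intro: INF_lower SUP_upper)
  moreover have "ereal (x - e / 2) < ereal x" "ereal x < ereal (x + e / 2)"
    using e(1) by simp_all
  ultimately show "left_endpoint J < ereal x \<and> ereal x < (SUP x\<in>J. ereal x)"
    by (meson le_less_trans less_le_trans)
next
  assume *: "left_endpoint J < ereal x \<and> ereal x < (SUP x\<in>J. ereal x)"
  then obtain z w where "z \<in> J" "z < x" "w \<in> J" "x < w"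
    unfolding left_endpoint_def INF_less_iff less_SUP_iff by auto
  then show "x \<in> J" using assms(2) by (meson less_imp_le mem_is_interval_1_I)
qed

text \<open>The order of endpoints is settled in \<open>ereal\<close> and then transferred by
  \<open>real_of_ereal\<close>. At an infinite outer endpoint this gives the default
  \<open>0\<close>, about which nothing is claimed.\<close>

lemma chain_endpoints:
  assumes "chain_of_intervals n J"
    and left: "\<And>i. i \<in> {1..<n} \<Longrightarrow> left_endpoint (J i) < left_endpoint (J (i + 1))"
  obtains a b z :: "nat \<Rightarrow> real"
  where "\<And>i x. i \<in> {2..n} \<Longrightarrow> x \<le> a i \<Longrightarrow> x \<notin> J i"
    and "\<And>i x. i \<in> {1..<n} \<Longrightarrow> b i \<le> x \<Longrightarrow> x \<notin> J i"
    and "\<And>i. i \<in> {1..<n} \<Longrightarrow> a (i + 1) \<in> J i"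
    and "\<And>i. i \<in> {1..<n} \<Longrightarrow> b i \<in> J (i + 1)"
    and "\<And>i. i \<in> {1..<n} \<Longrightarrow> a (i + 1) < b i"
    and "\<And>i. 1 \<le> i \<Longrightarrow> i + 2 \<le> n \<Longrightarrow> b i \<le> a (i + 2)"
    and "\<And>i. i \<in> {1..<n} \<Longrightarrow> z i \<in> J i \<inter> J (i + 1)"
proof -
  define L where "L i = left_endpoint (J i)" for i
  define R where "R i = (SUP x\<in>J i. ereal x)" for i
  have mem: "x \<in> J i \<longleftrightarrow> L i < ereal x \<and> ereal x < R i" if "i \<in> {1..n}" for i x
    unfolding L_def R_def
    by (rule open_interval_endpoints) (use assms(1) that in \<open>simp_all add: chain_of_intervals_def\<close>)
  have LL: "L i < L (i + 1)" if "i \<in> {1..<n}" for i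
    using left that by (simp add: L_def)
  have nonempty: "J i \<inter> J (i + 1) \<noteq> {}" and proper: "J i \<inter> J (i + 1) \<subset> J (i + 1)"
    if "i \<in> {1..<n}" for i
    using assms(1) that unfolding chain_of_intervals_def by blast+
  have LR: "L (i + 1) < R i" if i: "i \<in> {1..<n}" for i
  proof -
    obtain x where "x \<in> J i" "x \<in> J (i + 1)" using nonempty[OF i] by blast
    then show ?thesis using mem[of i x] mem[of "i + 1" x] i by (auto intro: less_trans)
  qed
  have RR: "R i < R (i + 1)" if i: "i \<in> {1..<n}" for i
  proof -
    \<comment> \<open>Such a point lies to the right of \<open>L (i + 1)\<close>, hence of
      \<open>L i\<close>, so it can miss \<open>J i\<close> only beyond \<open>R i\<close>.\<close>
    obtain x where "x \<in> J (i + 1)" "x \<notin> J i" using proper[OF i] by blast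
    then have x: "L (i + 1) < ereal x" "ereal x < R (i + 1)" "\<not> (L i < ereal x \<and> ereal x < R i)"
      using mem[of i x] mem[of "i + 1" x] i by auto
    then have "R i \<le> ereal x" using LL[OF i] by (meson less_trans not_le)
    with x show ?thesis by (meson le_less_trans)
  qed
  \<comment> \<open>An inner endpoint lies strictly between two others and is therefore
    finite.\<close>
  have finL: "ereal (real_of_ereal (L i)) = L i" if "i \<in> {2..n}" for i
  proof -
    have i: "i - 1 \<in> {1..<n}" "i - 1 + 1 = i" using that by auto
    have "L (i - 1) < L i" "L i < R (i - 1)" using LL[OF i(1)] LR[OF i(1)] i(2) by auto
    then show ?thesis by (intro ereal_real') auto
  qed
  have finR: "ereal (real_of_ereal (R i)) = R i" if "i \<in> {1..<n}" for i
  proof -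
    have "L (i + 1) < R i" "R i < R (i + 1)" using LR RR that by auto
    then show ?thesis by (intro ereal_real') auto
  qed
  show ?thesis
  proof
    fix i x assume i: "i \<in> {2..n}" and "x \<le> real_of_ereal (L i)"
    then have "ereal x \<le> L i" using finL[OF i] by (metis ereal_less_eq(3))
    then show "x \<notin> J i" using i mem[of i x] by auto
  next
    fix i x assume i: "i \<in> {1..<n}" and "real_of_ereal (R i) \<le> x"
    then have "R i \<le> ereal x" using finR[OF i] by (metis ereal_less_eq(3))
    then show "x \<notin> J i" using i mem[of i x] by auto
  next
    fix i assume i: "i \<in> {1..<n}"
    have fin: "ereal (real_of_ereal (L (i + 1))) = L (i + 1)" "ereal (real_of_ereal (R i)) = R i"
      using finL[of "i + 1"] finR[of i] i by auto
    show "real_of_ereal (L (i + 1)) \<in> J i"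
      using mem[of i] LL[OF i] LR[OF i] fin i by auto
    show "real_of_ereal (R i) \<in> J (i + 1)"
      using mem[of "i + 1"] LR[OF i] RR[OF i] fin i by auto
    show "real_of_ereal (L (i + 1)) < real_of_ereal (R i)"
      using LR[OF i] fin by (metis ereal_less(3) less_ereal.simps(1))
    show "(SOME x. x \<in> J i \<inter> J (i + 1)) \<in> J i \<inter> J (i + 1)"
      using nonempty[OF i] by (meson ex_in_conv someI_ex)
  next
    fix i :: nat assume i: "1 \<le> i" "i + 2 \<le> n"
    have "J i \<inter> J (i + 2) = {}" using assms(1) i by (auto simp: chain_of_intervals_def)
    have "R i \<le> L (i + 2)"
    proof (rule ccontr)
      assume "\<not> R i \<le> L (i + 2)"
      then obtain x where x: "L (i + 2) < ereal x" "ereal x < R i"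
        using ereal_dense2 by (metis not_le)
      moreover have "L i < L (i + 2)" "R i < R (i + 2)"
        using LL[of i] LL[of "i + 1"] RR[of i] RR[of "i + 1"] i by (auto intro: less_trans)
      ultimately have "x \<in> J i \<inter> J (i + 2)"
        using mem[of i x] mem[of "i + 2" x] i by (auto intro: less_trans)
      with \<open>J i \<inter> J (i + 2) = {}\<close> show False by blast
    qed
    then show "real_of_ereal (R i) \<le> real_of_ereal (L (i + 2))"
      using finR[of i] finL[of "i + 2"] i by (metis atLeastAtMost_iff atLeastLessThan_iff ereal_less_eq(3) le_add2 less_le_trans less_add_same_cancel1 zero_less_numeral)
  qed
qed

text \<open>Lets the subgroup of the chain group be treated as a subgroup of
  \<open>Homeo_plus\<close>.\<close>

lemma (in group) subgroup_generated_nested: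
  assumes "S \<subseteq> carrier (subgroup_generated G K)"
  shows "subgroup_generated (subgroup_generated G K) S = subgroup_generated G S"
proof -
  let ?C = "generate G (carrier G \<inter> K)"
  have C: "subgroup ?C G" by (rule generate_is_subgroup) simp
  have S: "S \<subseteq> ?C" using assms by (simp add: carrier_subgroup_generated)
  then have "S \<subseteq> carrier G" using subgroup.subset[OF C] by blast
  with S show ?thesis
    by (simp add: subgroup_generated_def generate_consistent[OF S C] Int_absorb1)
qed

lemma funpow_ge: "(\<And>x::real. x \<le> f x) \<Longrightarrow> x \<le> (f ^^ N) x"
  by (induction N) (auto intro: order_trans)

theorem proposition1p10:
  fixes n :: nat and f :: "nat \<Rightarrow> real \<Rightarrow> real" and G :: "(real \<Rightarrow> real) monoid"
  assumes "n \<ge> 2" and "chain_group n f G"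
  shows "\<exists>N0::nat. \<forall>N>N0.
    subgroup_generated G ((\<lambda>h. h [^]\<^bsub>G\<^esub> N) ` f ` {1..n}) \<cong> Higman_Thompson n"
proof -
  have carr: "f i \<in> carrier Homeo_plus" and ge: "x \<le> f i x" if "i \<in> {1..n}" for i x
    using assms(2) that by (auto simp: chain_group_def)
  have G: "G = subgroup_generated Homeo_plus (f ` {1..n})"
    and chain: "chain_of_intervals n (\<lambda>i. supp (f i))"
    using assms(2) by (auto simp: chain_group_def)
  have left: "left_endpoint (supp (f i)) < left_endpoint (supp (f (i + 1)))" if "i \<in> {1..<n}" for i
    using assms(2) that by (auto simp: chain_group_def)
  obtain a b z where
        fix_left: "\<And>i x. i \<in> {2..n} \<Longrightarrow> x \<le> a i \<Longrightarrow> x \<notin> supp (f i)"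
    and fix_right: "\<And>i x. i \<in> {1..<n} \<Longrightarrow> b i \<le> x \<Longrightarrow> x \<notin> supp (f i)"
    and a: "\<And>i. i \<in> {1..<n} \<Longrightarrow> a (i + 1) \<in> supp (f i)"
    and b: "\<And>i. i \<in> {1..<n} \<Longrightarrow> b i \<in> supp (f (i + 1))"
    and overlap: "\<And>i. i \<in> {1..<n} \<Longrightarrow> a (i + 1) < b i"
    and disjoint: "\<And>i. 1 \<le> i \<Longrightarrow> i + 2 \<le> n \<Longrightarrow> b i \<le> a (i + 2)"
    and z: "\<And>i. i \<in> {1..<n} \<Longrightarrow> z i \<in> supp (f i) \<inter> supp (f (i + 1))"
  proof (rule chain_endpoints[OF chain left], assumption, goal_cases)
    case (1 a b z)
    show ?case by (rule 1(1)[OF 1(2-8)])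
  qed
  \<comment> \<open>Milestones for the climb from \<open>a 2\<close> to \<open>b (n - 1)\<close>:
    \<open>c (i - 1)\<close> and \<open>c i\<close> both lie in the support of \<open>f i\<close>,
    so high powers of \<open>f i\<close> carry the first past the second.\<close>
  define c where "c i = (if i = 0 then a 2 else if i = n then b (n - 1) else z i)" for i
  have c: "c i \<in> supp (f i)" "c (i - 1) \<in> supp (f i)" if "i \<in> {1..n}" for i
  proof -
    show "c i \<in> supp (f i)" using b[of "n - 1"] z[of i] that \<open>n \<ge> 2\<close> by (auto simp: c_def)
    show "c (i - 1) \<in> supp (f i)"
    proof (cases "i = 1")
      case True
      then show ?thesis using a[of 1] \<open>n \<ge> 2\<close> by (simp add: c_def numeral_2_eq_2)
    next
      case False
      then have i: "i - 1 \<in> {1..<n}" "i - 1 + 1 = i" using that by auto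
      then show ?thesis using z[OF i(1)] by (auto simp: c_def)
    qed
  qed
  have "\<forall>\<^sub>F N in sequentially. \<forall>i\<in>{1..n}. c i \<le> (f i ^^ N) (c (i - 1))"
  proof (intro eventually_ball_finite ballI iterates_eventually_ge)
    fix i assume i: "i \<in> {1..n}"
    show "is_interval (supp (f i))" using chain i by (auto simp: chain_of_intervals_def)
  qed (use c carr ge Homeo_plus_continuous in auto)
  then obtain N0 where N0: "\<And>N i. N0 \<le> N \<Longrightarrow> i \<in> {1..n} \<Longrightarrow> c i \<le> (f i ^^ N) (c (i - 1))"
    unfolding eventually_sequentially by blast
  show ?thesis
  proof (intro exI allI impI)
    fix N assume "N > N0"
    define h where "h i = f i ^^ N" for i
    have h_carrier: "h i \<in> carrier Homeo_plus" if "i \<in> {1..n}" for i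
      using Homeo.nat_pow_closed[OF carr[OF that], of N] by (simp add: h_def Homeo_plus_pow)
    have h_fix: "h i x = x" if "x \<notin> supp (f i)" for i x
      using that unfolding h_def supp_def by (induction N) auto
    have climb: "c d \<le> segment h 0 d (a 2)" if "d \<le> n" for d
      using that
    proof (induction d)
      case (Suc d)
      have "c (Suc d) \<le> h (Suc d) (c d)"
        using N0[of N "Suc d"] \<open>N > N0\<close> Suc.prems by (simp add: h_def)
      also have "\<dots> \<le> h (Suc d) (segment h 0 d (a 2))"
        using Suc h_carrier[of "Suc d", THEN Homeo_plus_strict_mono] by (simp add: strict_mono_less_eq)
      finally show ?case by simp
    qed (simp add: c_def)
    interpret fast_chain n h a b
    proof
      show "a (i + 1) < h i (a (i + 1))" if i: "i \<in> {1..<n}" for i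
      proof -
        \<comment> \<open>\<open>N > N0\<close> makes \<open>N\<close> positive; one of the
          applications of \<open>f i\<close> supplies the strict inequality.\<close>
        obtain M where M: "N = Suc M" using \<open>N > N0\<close> by (cases N) auto
        have "a (i + 1) \<le> (f i ^^ M) (a (i + 1))" using ge i by (intro funpow_ge) simp
        then have "f i (a (i + 1)) \<le> h i (a (i + 1))"
          using Homeo_plus_strict_mono[OF carr[of i]] i by (simp add: h_def M strict_mono_less_eq)
        moreover have "a (i + 1) < f i (a (i + 1))"
          using a[OF i] ge[of i "a (i + 1)"] i by (simp add: supp_def)
        ultimately show ?thesis by simp
      qed
      show "b (n - 1) \<le> segment h 0 n (a 2)"
        using climb[of n] \<open>n \<ge> 2\<close> by (simp add: c_def)
      show "x \<le> h i x" if "i \<in> {1..n}" for i x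
        unfolding h_def using ge that by (intro funpow_ge)
    qed (use \<open>n \<ge> 2\<close> h_carrier h_fix fix_left fix_right overlap disjoint in auto)
    have S: "(\<lambda>u. u [^]\<^bsub>G\<^esub> N) ` f ` {1..n} = h ` {1..n}"
      by (simp add: G pow_subgroup_generated Homeo_plus_pow h_def image_image)
    interpret G: group G unfolding G by simp
    have "f ` {1..n} \<subseteq> carrier G"
      unfolding G using carr by (intro Homeo.subgroup_generated_subset_carrier_subset) auto
    then have "h ` {1..n} \<subseteq> carrier G"
      unfolding S[symmetric] by (auto intro!: G.nat_pow_closed)
    then show "subgroup_generated G ((\<lambda>h. h [^]\<^bsub>G\<^esub> N) ` f ` {1..n}) \<cong> Higman_Thompson n"
      using subgroup_generated_iso unfolding S unfolding G by (simp only: Homeo.subgroup_generated_nested)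
  qed
qed

end
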